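(* Let $n,m$ be positive integers such that neither one of $n,m$ divides the other. Then every extremal array $A\in\mathcal{S}_{n,m}$ has support size of the form $$|\operatorname{supp}A| = n+m-s$$ for some integer $s$ with $1\leq s\leq\gcd(n,m)$. Conversely, for every integer $s$ with $1\leq s\leq\gcd(n,m)$, there exists an extremal array $A\in\mathcal{S}_{n,m}$ such that $|\operatorname{supp}A| = n+m-s$.
   Context: An $n\times m$ real matrix $A=(a_{ij})$ is called a doubly stochastic array (with uniform marginals) if $a_{ij}\geq 0$ for all $i,j$, $\sum_{j=1}^m a_{ij}=m$ for every $1\leq i\leq n$, and $\sum_{i=1}^n a_{ij}=n$ for every $1\leq j\leq m$. The set of all such arrays is denoted $\mathcal{S}_{n,m}$; it is a convex polytope. An array $A\in\mathcal{S}_{n,m}$ is called extremal if it is an extreme point of $\mathcal{S}_{n,m}$, i.e. it cannot be represented as a convex combination of two other elements of $\mathcal{S}_{n,m}$ that are both different from $A$. The support of a matrix $A=(a_{ij})$ is $\operatorname{supp}A=\{(i,j): a_{ij}\neq 0\}$. *)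

theory Defs
  imports "HOL-Analysis.Analysis"
begin

text \<open>
  An \<open>n \<times> m\<close> real matrix is an element of \<^typ>\<open>real ^ 'm ^ 'n\<close> with \<open>n = CARD('n)\<close> rows and
  \<open>m = CARD('m)\<close> columns; \<open>A $ i $ j\<close> is the entry in row \<open>i\<close>, column \<open>j\<close>.
  Extremal arrays are extreme points in the sense of \<^const>\<open>extreme_point_of\<close>.
\<close>

definition doubly_stochastic_arrays :: "(real ^ 'm::finite ^ 'n::finite) set" where
  "doubly_stochastic_arrays =
     {A. (\<forall>i j. A $ i $ j \<ge> 0) \<and>
         (\<forall>i. (\<Sum>j\<in>UNIV. A $ i $ j) = real CARD('m)) \<and>
         (\<forall>j. (\<Sum>i\<in>UNIV. A $ i $ j) = real CARD('n))}"

definition matrix_supp :: "real ^ 'm ^ 'n \<Rightarrow> ('n \<times> 'm) set" where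
  "matrix_supp A = {(i, j). A $ i $ j \<noteq> 0}"

end

theory Submission
  imports Defs
begin

text \<open>
  Read the support of an array as the edge set of a bipartite graph between the \<open>n\<close> rows and the
  \<open>m\<close> columns. An array is extremal exactly when its support carries no nonzero matrix with
  vanishing row and column sums (\<open>extreme_point_imp_circulation_free\<close>,
  \<open>circulation_free_imp_extreme_point\<close>), that is, when the graph is a forest. A forest on
  \<open>n + m\<close> vertices with \<open>s\<close> components has \<open>n + m - s\<close> edges, so \<open>s\<close> counts components.

  A component with \<open>a\<close> rows and \<open>b\<close> columns carries the total weight \<open>m a = n b\<close>, so \<open>a\<close> is a
  positive multiple of \<open>n / gcd n m\<close>. The rows therefore leave room for at most \<open>gcd n m\<close>
  components (\<open>supp_card_lower\<close>), and \<open>s \<ge> 1\<close> is the bound for the size of a forest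
  (\<open>circulation_free_card\<close>).

  For the converse, an extreme point of the face of all arrays supported in \<open>gcd n m\<close> equal diagonal
  blocks has at least, hence exactly, \<open>gcd n m\<close> components (\<open>ex_extreme_point_card_gcd\<close>). The number
  of components is then lowered one at a time. Take edges \<open>(p, q)\<close> and \<open>(p', q')\<close> in different
  components with entries \<open>x < y\<close>. Moving the weight \<open>x\<close> from these two cells to \<open>(p, q')\<close> and
  \<open>(p', q)\<close> deletes the edge \<open>(p, q)\<close>, keeps \<open>(p', q')\<close> with weight \<open>y - x\<close>, and ties both halves of
  the first component to the second one: the result is again a forest, with one component fewer
  (\<open>join_components\<close>). Such a pair of edges exists as soon as there are two components and the
  nonzero entries are not all equal. The divisibility hypotheses enter only here: if all nonzero
  entries were equal, all rows would have the same degree, and so would all columns; a forest has a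
  vertex of degree one, and then \<open>n\<close> divides \<open>m\<close> or conversely (\<open>not_constant_on_supp\<close>).
\<close>

section \<open>Circulations and extreme points\<close>

definition circulation :: "real ^ 'm ^ 'n \<Rightarrow> bool" where
  "circulation B \<longleftrightarrow> (\<forall>i. (\<Sum>j\<in>UNIV. B $ i $ j) = 0) \<and> (\<forall>j. (\<Sum>i\<in>UNIV. B $ i $ j) = 0)"

text \<open>
  Acyclicity of the bipartite graph \<open>E\<close> in linear form: alternating signs along a cycle give a nonzero
  circulation, and every nonzero circulation has a cycle in its support. In this form acyclicity can
  be compared directly with extremality, and no paths have to be handled.
\<close>
definition circulation_free :: "('n::finite \<times> 'm::finite) set \<Rightarrow> bool" where
  "circulation_free E \<longleftrightarrow>
     (\<forall>B :: real ^ 'm ^ 'n. circulation B \<and> matrix_supp B \<subseteq> E \<longrightarrow> B = 0)"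

lemma circulation_freeD:
  fixes B :: "real ^ 'm ^ 'n"
  assumes "circulation_free E" "circulation B" "\<And>i j. (i, j) \<notin> E \<Longrightarrow> B $ i $ j = 0"
  shows "B = 0"
  using assms unfolding circulation_free_def matrix_supp_def by blast

lemma circulation_free_mono: "circulation_free E \<Longrightarrow> F \<subseteq> E \<Longrightarrow> circulation_free F"
  unfolding circulation_free_def by blast

text \<open>
  Nonnegativity forces both ends of a segment through \<open>A\<close> to vanish wherever \<open>A\<close> does, so the
  difference between an end and \<open>A\<close> is a circulation on the support of \<open>A\<close>.
\<close>
lemma circulation_free_imp_extreme_point:
  fixes A :: "real ^ 'm ^ 'n"
  assumes A: "A \<in> doubly_stochastic_arrays" and free: "circulation_free (matrix_supp A)"
  shows "A extreme_point_of doubly_stochastic_arrays"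
  unfolding extreme_point_of_def
proof (intro conjI ballI notI A)
  fix X Y :: "real ^ 'm ^ 'n"
  assume X: "X \<in> doubly_stochastic_arrays" and Y: "Y \<in> doubly_stochastic_arrays"
    and seg: "A \<in> open_segment X Y"
  from seg obtain u where u: "0 < u" "u < 1" and AXY: "A = (1 - u) *\<^sub>R X + u *\<^sub>R Y" and "X \<noteq> Y"
    by (auto simp: in_segment)
  have X0: "X $ i $ j = 0" if "(i, j) \<notin> matrix_supp A" for i j
  proof -
    have "(1 - u) * X $ i $ j + u * Y $ i $ j = 0"
      using that by (simp add: matrix_supp_def AXY)
    moreover have "(1 - u) * X $ i $ j \<ge> 0" "u * Y $ i $ j \<ge> 0"
      using X Y u by (auto simp: doubly_stochastic_arrays_def)
    ultimately have "(1 - u) * X $ i $ j = 0" by linarith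
    then show ?thesis using u by simp
  qed
  have "circulation (X - A)"
    using X A by (simp add: circulation_def doubly_stochastic_arrays_def sum_subtractf)
  then have "X - A = 0"
    by (rule circulation_freeD[OF free]) (use X0 in \<open>auto simp: matrix_supp_def\<close>)
  moreover have "X - A = u *\<^sub>R (X - Y)" by (simp add: AXY algebra_simps)
  ultimately have "u *\<^sub>R (X - Y) = 0" by (simp only:)
  then show False using u \<open>X \<noteq> Y\<close> by simp
qed

text \<open>
  A circulation on the support could be added to and subtracted from \<open>A\<close> in a small multiple, making
  \<open>A\<close> a midpoint. Both perturbed arrays vanish outside \<open>F\<close> again, so the argument works within each
  face given by a prescribed set \<open>F\<close> of admissible cells; proper faces serve to find extreme points
  with a prescribed block structure.
\<close>
lemma extreme_point_of_face_imp_circulation_free: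
  fixes A :: "real ^ 'm ^ 'n"
  assumes ext: "A extreme_point_of {A \<in> doubly_stochastic_arrays. matrix_supp A \<subseteq> F}"
  shows "circulation_free (matrix_supp A)"
  unfolding circulation_free_def
proof (intro allI impI, rule ccontr)
  fix B :: "real ^ 'm ^ 'n"
  assume B: "circulation B \<and> matrix_supp B \<subseteq> matrix_supp A" and nz: "B \<noteq> 0"
  have A: "A \<in> doubly_stochastic_arrays" "matrix_supp A \<subseteq> F"
    using ext by (auto simp: extreme_point_of_def)
  have B_supp: "B $ i $ j = 0" if "A $ i $ j = 0" for i j
  proof -
    have "(i, j) \<notin> matrix_supp B" using B that by (auto simp: matrix_supp_def)
    then show ?thesis by (simp add: matrix_supp_def)
  qed
  have "\<forall>\<^sub>F e in at_right 0. e * \<bar>B $ i $ j\<bar> \<le> A $ i $ j" for i j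
  proof (cases "B $ i $ j = 0")
    case True
    then show ?thesis using A by (simp add: doubly_stochastic_arrays_def)
  next
    case False
    then have "A $ i $ j \<noteq> 0" using B_supp by blast
    then have "A $ i $ j > 0"
      using A by (auto simp: doubly_stochastic_arrays_def less_le)
    then have "0 < A $ i $ j / \<bar>B $ i $ j\<bar>" using False by simp
    from eventually_at_right_real[OF this] show ?thesis
      by eventually_elim (use False in \<open>simp add: field_simps\<close>)
  qed
  then have "\<forall>\<^sub>F e in at_right 0. \<forall>i j. e * \<bar>B $ i $ j\<bar> \<le> A $ i $ j"
    by (intro eventually_all_finite)
  moreover have "\<forall>\<^sub>F e in at_right (0::real). 0 < e"
    by (rule eventually_at_right_less)
  ultimately have "\<forall>\<^sub>F e in at_right 0. 0 < e \<and> (\<forall>i j. e * \<bar>B $ i $ j\<bar> \<le> A $ i $ j)"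
    by eventually_elim blast
  from eventually_happens[OF this] obtain e :: real
    where e: "0 < e" and le: "\<And>i j. e * \<bar>B $ i $ j\<bar> \<le> A $ i $ j"
    by auto
  have mem: "A + t *\<^sub>R B \<in> {A \<in> doubly_stochastic_arrays. matrix_supp A \<subseteq> F}" if t: "\<bar>t\<bar> = e" for t
  proof -
    have "\<bar>t * B $ i $ j\<bar> \<le> A $ i $ j" for i j
      using le t by (simp add: abs_mult)
    then have "A $ i $ j + t * B $ i $ j \<ge> 0" for i j
      by (smt (verit, best))
    moreover have "(\<Sum>j\<in>UNIV. A $ i $ j + t * B $ i $ j) = real CARD('m)" for i
      using A B by (simp add: sum.distrib circulation_def doubly_stochastic_arrays_def
          flip: sum_distrib_left)
    moreover have "(\<Sum>i\<in>UNIV. A $ i $ j + t * B $ i $ j) = real CARD('n)" for j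
      using A B by (simp add: sum.distrib circulation_def doubly_stochastic_arrays_def
          flip: sum_distrib_left)
    moreover have "matrix_supp (A + t *\<^sub>R B) \<subseteq> F"
    proof (clarsimp simp: matrix_supp_def)
      fix i j assume "A $ i $ j + t * B $ i $ j \<noteq> 0"
      then have "A $ i $ j \<noteq> 0" using B_supp by force
      then show "(i, j) \<in> F" using A(2) by (auto simp: matrix_supp_def)
    qed
    ultimately show ?thesis by (simp add: doubly_stochastic_arrays_def)
  qed
  have "midpoint (A + e *\<^sub>R B) (A + (- e) *\<^sub>R B) = A"
    by (simp add: midpoint_def algebra_simps flip: scaleR_2)
  moreover have "A + e *\<^sub>R B \<noteq> A + (- e) *\<^sub>R B"
  proof
    assume "A + e *\<^sub>R B = A + (- e) *\<^sub>R B"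
    then have "(2 * e) *\<^sub>R B = 0" by (simp add: scaleR_2[symmetric] eq_neg_iff_add_eq_0 flip: scaleR_scaleR)
    then show False using e nz by simp
  qed
  ultimately have "A \<in> open_segment (A + e *\<^sub>R B) (A + (- e) *\<^sub>R B)"
    by (metis midpoint_in_open_segment)
  then show False
    using ext mem[of e] mem[of "- e"] e unfolding extreme_point_of_def by auto
qed

lemma extreme_point_imp_circulation_free:
  fixes A :: "real ^ 'm ^ 'n"
  assumes "A extreme_point_of doubly_stochastic_arrays"
  shows "circulation_free (matrix_supp A)"
  using extreme_point_of_face_imp_circulation_free[of A UNIV] assms by simp

section \<open>Counting cells through components\<close>

text \<open>
  Send the cell \<open>(i, j)\<close> to the pair of unit vectors \<open>(e\<^sub>i, e\<^sub>j)\<close>. A linear relation between these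
  vectors is a circulation, so the cells of \<open>E\<close> give independent vectors. All of them lie in the span
  of the \<open>|R| + |C| - 1\<close> vectors that belong to one fixed column and one fixed row.
\<close>
lemma circulation_free_card:
  fixes E :: "('n::finite \<times> 'm::finite) set"
  assumes free: "circulation_free E" and E: "E \<subseteq> R \<times> C" and "R \<noteq> {}" "C \<noteq> {}"
  shows "card E + 1 \<le> card R + card C"
proof -
  define v :: "'n \<times> 'm \<Rightarrow> (real ^ 'n) \<times> (real ^ 'm)"
    where "v = (\<lambda>(i, j). (axis i 1, axis j 1))"
  have inj: "inj v" by (auto simp: inj_on_def v_def axis_eq_axis)
  have "independent (v ` E)"
  proof
    assume "dependent (v ` E)"
    then obtain u where u: "\<exists>x\<in>v ` E. u x \<noteq> 0" and "(\<Sum>x\<in>v ` E. u x *\<^sub>R x) = 0"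
      by (auto simp: dependent_finite)
    then have 0: "(\<Sum>e\<in>E. u (v e) *\<^sub>R v e) = 0"
      by (simp add: sum.reindex[OF inj_on_subset[OF inj]])
    define B :: "real ^ 'm ^ 'n" where "B = (\<chi> i j. if (i, j) \<in> E then u (v (i, j)) else 0)"
    have sumE: "(\<Sum>e\<in>E. u (v e) * g e) = (\<Sum>i\<in>UNIV. \<Sum>j\<in>UNIV. B $ i $ j * g (i, j))" for g
    proof -
      have "(\<Sum>e\<in>E. u (v e) * g e) = (\<Sum>e\<in>UNIV. (if e \<in> E then u (v e) else 0) * g e)"
        by (rule sum.mono_neutral_cong_left) auto
      also have "\<dots> = (\<Sum>(i, j)\<in>UNIV \<times> UNIV. B $ i $ j * g (i, j))"
        by (rule sum.cong) (auto simp: B_def)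
      finally show ?thesis by (simp only: sum.cartesian_product)
    qed
    have "(\<Sum>j\<in>UNIV. B $ i $ j) = 0" for i
    proof -
      have "0 = fst (\<Sum>e\<in>E. u (v e) *\<^sub>R v e) $ i" by (simp add: 0)
      also have "\<dots> = (\<Sum>e\<in>E. u (v e) * (if fst e = i then 1 else 0))"
        by (auto simp: fst_sum v_def axis_def intro!: sum.cong)
      also have "\<dots> = (\<Sum>k\<in>UNIV. \<Sum>j\<in>UNIV. B $ k $ j * (if k = i then 1 else 0))"
        by (simp add: sumE)
      also have "\<dots> = (\<Sum>k\<in>UNIV. if k = i then (\<Sum>j\<in>UNIV. B $ k $ j) else 0)"
        by (intro sum.cong) auto
      finally show ?thesis by simp
    qed
    moreover have "(\<Sum>i\<in>UNIV. B $ i $ j) = 0" for j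
    proof -
      have "0 = snd (\<Sum>e\<in>E. u (v e) *\<^sub>R v e) $ j" by (simp add: 0)
      also have "\<dots> = (\<Sum>e\<in>E. u (v e) * (if snd e = j then 1 else 0))"
        by (auto simp: snd_sum v_def axis_def intro!: sum.cong)
      also have "\<dots> = (\<Sum>i\<in>UNIV. \<Sum>k\<in>UNIV. if k = j then B $ i $ k else 0)"
        by (subst sumE) (intro sum.cong, auto)
      finally show ?thesis by simp
    qed
    ultimately have "circulation B" by (simp add: circulation_def)
    then have "B = 0" by (rule circulation_freeD[OF free]) (simp add: B_def)
    then have "u (v (i, j)) = 0" if "(i, j) \<in> E" for i j
      using that by (simp add: B_def vec_eq_iff split: if_splits)
    then show False using u by auto
  qed
  obtain p q where pq: "p \<in> R" "q \<in> C" using assms by blast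
  \<comment> \<open>Without column \<open>q\<close> in the second part, \<open>v (p, q)\<close> is counted once; this saves the 1.\<close>
  let ?T = "(\<lambda>i. v (i, q)) ` R \<union> (\<lambda>j. v (p, j)) ` (C - {q})"
  have "v ` E \<subseteq> span ?T"
  proof (rule image_subsetI)
    fix e assume "e \<in> E"
    then obtain i j where e: "e = (i, j)" and ij: "i \<in> R" "j \<in> C" using E by blast
    have in_span: "v (i, q) \<in> span ?T" "v (p, q) \<in> span ?T"
      using ij pq by (auto intro: span_base)
    have "v (p, j) \<in> span ?T"
      using in_span(2) ij by (cases "j = q") (auto intro: span_base)
    with in_span have "v (i, q) - v (p, q) + v (p, j) \<in> span ?T"
      by (intro span_add span_diff)
    moreover have "v (i, q) - v (p, q) + v (p, j) = v (i, j)"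
      by (simp add: v_def)
    ultimately show "v e \<in> span ?T" by (simp only: e)
  qed
  with \<open>independent (v ` E)\<close> have "card (v ` E) \<le> card ?T"
    using independent_span_bound[of ?T "v ` E"] by simp
  also have "\<dots> \<le> card R + card (C - {q})"
    using card_Un_le card_image_le add_mono finite order_trans by meson
  finally have "card (v ` E) \<le> card R + card (C - {q})" .
  moreover have "card (v ` E) = card E" by (rule card_image[OF inj_on_subset[OF inj]]) simp
  moreover have "card C = Suc (card (C - {q}))" using pq card.remove[of C q] by simp
  ultimately show ?thesis by simp
qed

text \<open>
  The labels play the role of connected components: each new edge merges two labels, so it lowers
  their number by at most one. The labels are vertices, so that the identity can serve as the labelling
  of the graph without edges.
\<close>
lemma component_labels:
  fixes E :: "('n::finite \<times> 'm::finite) set"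
  shows "\<exists>h :: 'n + 'm \<Rightarrow> 'n + 'm. (\<forall>(i, j)\<in>E. h (Inl i) = h (Inr j)) \<and>
           CARD('n) + CARD('m) \<le> card (range h) + card E"
proof (induction E rule: finite_induct[OF finite])
  case 1
  show ?case by (rule exI[of _ "\<lambda>x. x"]) (simp add: UNIV_Plus_UNIV[symmetric] card_Plus del: UNIV_Plus_UNIV)
next
  case (2 e E)
  obtain p q where e: "e = (p, q)" by force
  from 2 obtain h :: "'n + 'm \<Rightarrow> 'n + 'm"
    where h: "\<And>i j. (i, j) \<in> E \<Longrightarrow> h (Inl i) = h (Inr j)"
      and c: "CARD('n) + CARD('m) \<le> card (range h) + card E" by blast
  define h' where "h' = (\<lambda>x. if h x = h (Inl p) then h (Inr q) else h x)"
  have "range h \<subseteq> insert (h (Inl p)) (range h')"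
    by (auto simp: h'_def)
  then have "card (range h) \<le> card (insert (h (Inl p)) (range h'))"
    by (intro card_mono) auto
  also have "\<dots> \<le> card (range h') + 1" by (simp add: card_insert_if)
  finally have "CARD('n) + CARD('m) \<le> card (range h') + card (insert e E)"
    using c 2 by simp
  moreover have "\<forall>(i, j)\<in>insert e E. h' (Inl i) = h' (Inr j)"
    using h by (auto simp: h'_def e)
  ultimately show ?case by blast
qed

text \<open>Both sides are the total weight of the block \<open>I \<times> J\<close>, summed by rows and by columns.\<close>
lemma separated_weights:
  fixes A :: "real ^ 'm ^ 'n"
  assumes A: "A \<in> doubly_stochastic_arrays"
    and sep: "\<And>i j. (i, j) \<in> matrix_supp A \<Longrightarrow> i \<in> I \<longleftrightarrow> j \<in> J"
  shows "CARD('m) * card I = CARD('n) * card J"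
proof -
  have z: "A $ i $ j = 0" if "(i \<in> I) \<noteq> (j \<in> J)" for i j
    using sep[of i j] that by (auto simp: matrix_supp_def)
  have "real (CARD('m) * card I) = (\<Sum>i\<in>I. \<Sum>j\<in>UNIV. A $ i $ j)"
    using A by (simp add: doubly_stochastic_arrays_def)
  also have "\<dots> = (\<Sum>i\<in>I. \<Sum>j\<in>J. A $ i $ j)"
    by (intro sum.cong refl sum.mono_neutral_right) (auto simp: z)
  also have "\<dots> = (\<Sum>j\<in>J. \<Sum>i\<in>I. A $ i $ j)" by (rule sum.swap)
  also have "\<dots> = (\<Sum>j\<in>J. \<Sum>i\<in>UNIV. A $ i $ j)"
    by (intro sum.cong refl sum.mono_neutral_left) (auto simp: z)
  also have "\<dots> = real (CARD('n) * card J)"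
    using A by (simp add: doubly_stochastic_arrays_def)
  finally show ?thesis by (simp only: of_nat_eq_iff)
qed

text \<open>
  With \<open>a\<close> rows and \<open>b\<close> columns in the class of \<open>l\<close>, the weight balance \<open>m a = n b\<close> makes \<open>a\<close> a multiple
  of \<open>n / gcd n m\<close>, and excludes classes that consist of columns only. The total number of rows
  then bounds the number of classes.
\<close>
lemma labels_on_rows:
  fixes A :: "real ^ 'm ^ 'n" and h :: "'n + 'm \<Rightarrow> 'v"
  assumes A: "A \<in> doubly_stochastic_arrays"
    and h: "\<And>i j. (i, j) \<in> matrix_supp A \<Longrightarrow> h (Inl i) = h (Inr j)"
    and l: "l \<in> range h"
  shows "CARD('n) div gcd CARD('n) CARD('m) \<le> card {i. h (Inl i) = l}"
    and "\<exists>i. h (Inl i) = l"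
proof -
  define n' m' where "n' = CARD('n) div gcd CARD('n) CARD('m)"
    and "m' = CARD('m) div gcd CARD('n) CARD('m)"
  let ?I = "{i. h (Inl i) = l}" and ?J = "{j. h (Inr j) = l}"
  have eq: "CARD('m) * card ?I = CARD('n) * card ?J"
    by (rule separated_weights[OF A]) (use h in auto)
  have ne: "?I \<noteq> {}"
  proof
    assume "?I = {}"
    then have "?J = {}" using eq by simp
    obtain x where "h x = l" using l by auto
    with \<open>?I = {}\<close> \<open>?J = {}\<close> show False by (cases x) auto
  qed
  then show "\<exists>i. h (Inl i) = l" by blast
  have n: "CARD('n) = gcd CARD('n) CARD('m) * n'" and m: "CARD('m) = gcd CARD('n) CARD('m) * m'"
    by (simp_all add: n'_def m'_def)
  have cop: "coprime n' m'"
    unfolding n'_def m'_def by (rule div_gcd_coprime) simp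
  have "gcd CARD('n) CARD('m) * (m' * card ?I) = gcd CARD('n) CARD('m) * (n' * card ?J)"
    using eq n m by (metis mult.assoc)
  then have "m' * card ?I = n' * card ?J" by simp
  then have "n' dvd m' * card ?I" by simp
  then have "n' dvd card ?I" using cop by (simp add: coprime_dvd_mult_right_iff)
  then show "CARD('n) div gcd CARD('n) CARD('m) \<le> card ?I"
    using ne unfolding n'_def by (intro dvd_imp_le) (auto simp: card_gt_0_iff)
qed

lemma supp_card_lower:
  fixes A :: "real ^ 'm ^ 'n"
  assumes A: "A \<in> doubly_stochastic_arrays"
  shows "CARD('n) + CARD('m) \<le> card (matrix_supp A) + gcd CARD('n) CARD('m)"
proof -
  obtain h :: "'n + 'm \<Rightarrow> 'n + 'm"
    where h: "\<And>i j. (i, j) \<in> matrix_supp A \<Longrightarrow> h (Inl i) = h (Inr j)"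
      and c: "CARD('n) + CARD('m) \<le> card (range h) + card (matrix_supp A)"
    using component_labels[of "matrix_supp A"] by blast
  let ?g = "gcd CARD('n) CARD('m)"
  let ?n = "CARD('n) div ?g"
  have "card (range h) * ?n = (\<Sum>l\<in>range h. ?n)" by simp
  also have "\<dots> \<le> (\<Sum>l\<in>range h. card {i. h (Inl i) = l})"
    by (rule sum_mono) (rule labels_on_rows(1)[OF A h])
  also have "\<dots> = card (\<Union>l\<in>range h. {i. h (Inl i) = l})"
    by (rule card_UN_disjoint[symmetric]) auto
  also have "\<dots> \<le> CARD('n)" by (rule card_mono) auto
  also have "\<dots> = ?g * ?n" by simp
  finally have "card (range h) * ?n \<le> ?g * ?n" .
  moreover have "?n > 0" by (simp add: div_greater_zero_iff)
  ultimately have "card (range h) \<le> ?g" by (simp only: mult_le_cancel2)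
  then show ?thesis using c by simp
qed

section \<open>An extremal array with the greatest number of components\<close>

lemma compact_doubly_stochastic_arrays:
  "compact (doubly_stochastic_arrays :: (real ^ 'm ^ 'n) set)"
proof (rule compact_eq_bounded_closed[THEN iffD2], rule conjI)
  have "norm A \<le> real CARD('n) * real CARD('m)"
    if A: "A \<in> doubly_stochastic_arrays" for A :: "real ^ 'm ^ 'n"
  proof -
    have "norm A \<le> (\<Sum>i\<in>UNIV. norm (A $ i))"
      unfolding norm_vec_def[of A] by (rule L2_set_le_sum) simp
    also have "\<dots> \<le> (\<Sum>i\<in>UNIV. \<Sum>j\<in>UNIV. \<bar>A $ i $ j\<bar>)"
      by (intro sum_mono norm_le_l1_cart)
    also have "\<dots> = real CARD('n) * real CARD('m)"
      using A by (simp add: doubly_stochastic_arrays_def)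
    finally show ?thesis .
  qed
  then show "bounded (doubly_stochastic_arrays :: (real ^ 'm ^ 'n) set)"
    by (auto simp: bounded_iff)
  show "closed (doubly_stochastic_arrays :: (real ^ 'm ^ 'n) set)"
    unfolding doubly_stochastic_arrays_def
    by (intro closed_Collect_conj closed_Collect_all closed_Collect_le closed_Collect_eq continuous_intros)
qed

lemma ex_equal_blocks:
  assumes "g dvd CARD('a::finite)"
  shows "\<exists>r :: 'a \<Rightarrow> nat. range r \<subseteq> {..<g} \<and> (\<forall>l<g. card {x. r x = l} = CARD('a) div g)"
proof -
  obtain k where k: "CARD('a) = g * k" using assms by blast
  have "k \<noteq> 0" "g \<noteq> 0" using k by (metis mult_0_right zero_less_card_finite less_irrefl mult_0)+
  obtain f :: "'a \<Rightarrow> nat" where f: "bij_betw f UNIV {0..<CARD('a)}"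
    using ex_bij_betw_finite_nat[OF finite] by blast
  have "card {x. f x mod g = l} = k" if "l < g" for l
  proof -
    have "bij_betw (\<lambda>t. t * g + l) {..<k} {y \<in> {0..<g * k}. y mod g = l}"
    proof (rule bij_betw_byWitness[where f' = "\<lambda>y. y div g"])
      show "(\<lambda>t. t * g + l) ` {..<k} \<subseteq> {y \<in> {0..<g * k}. y mod g = l}"
      proof (rule image_subsetI)
        fix t assume "t \<in> {..<k}"
        then have "Suc t * g \<le> k * g" by (intro mult_le_mono) auto
        then show "t * g + l \<in> {y \<in> {0..<g * k}. y mod g = l}" using that by (simp add: mult.commute)
      qed
      show "(\<lambda>y. y div g) ` {y \<in> {0..<g * k}. y mod g = l} \<subseteq> {..<k}"
        by (auto simp: less_mult_imp_div_less mult.commute)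
    qed (use that \<open>g \<noteq> 0\<close> in \<open>auto simp: mult.commute\<close>)
    then have "card {y \<in> {0..<g * k}. y mod g = l} = k"
      using bij_betw_same_card by fastforce
    moreover have "bij_betw f {x. f x mod g = l} {y \<in> {0..<g * k}. y mod g = l}"
      using f unfolding bij_betw_def k by (fastforce intro: inj_on_subset)
    ultimately show ?thesis by (simp only: bij_betw_same_card[of f "{x. f x mod g = l}"])
  qed
  then show ?thesis using \<open>g \<noteq> 0\<close> k by (intro exI[of _ "\<lambda>x. f x mod g"]) auto
qed

text \<open>
  The arrays supported in the diagonal blocks of a partition into \<open>g = gcd n m\<close> equal parts form a
  nonempty compact convex set, which has an extreme point. Its support is a forest within each of the
  \<open>g\<close> blocks, hence misses the vertex count by at least one in each of them. Extremality among all
  arrays follows because it depends on the support alone.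
\<close>
lemma ex_extreme_point_card_gcd:
  "\<exists>A :: real ^ 'm ^ 'n. A extreme_point_of doubly_stochastic_arrays \<and>
     card (matrix_supp A) + gcd CARD('n) CARD('m) = CARD('n) + CARD('m)"
proof -
  define g where "g = gcd CARD('n) CARD('m)"
  define n' m' where "n' = CARD('n) div g" and "m' = CARD('m) div g"
  have n: "CARD('n) = g * n'" and m: "CARD('m) = g * m'"
    by (simp_all add: g_def n'_def m'_def)
  have pos: "g > 0" "n' > 0" "m' > 0" using n m by (auto intro!: gr0I)
  obtain r :: "'n \<Rightarrow> nat" where r: "range r \<subseteq> {..<g}" "\<And>l. l < g \<Longrightarrow> card {i. r i = l} = n'"
    using ex_equal_blocks[of g, where 'a = 'n] by (auto simp: g_def n'_def)
  obtain c :: "'m \<Rightarrow> nat" where c: "range c \<subseteq> {..<g}" "\<And>l. l < g \<Longrightarrow> card {j. c j = l} = m'"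
    using ex_equal_blocks[of g, where 'a = 'm] by (auto simp: g_def m'_def)
  define S :: "(real ^ 'm ^ 'n) set"
    where "S = {A \<in> doubly_stochastic_arrays. matrix_supp A \<subseteq> {(i, j). r i = c j}}"
  have S_eq: "S = doubly_stochastic_arrays \<inter> {A. \<forall>i j. r i \<noteq> c j \<longrightarrow> A $ i $ j = 0}"
    by (auto simp: S_def matrix_supp_def)
  have "compact S" unfolding S_eq
    by (intro compact_Int_closed compact_doubly_stochastic_arrays closed_Collect_all
        closed_Collect_imp closed_Collect_eq open_Collect_const continuous_intros)
  moreover have "convex S" unfolding S_eq
    by (auto simp: convex_def doubly_stochastic_arrays_def sum.distrib
        simp flip: sum_distrib_left distrib_right)
  \<comment> \<open>A block has \<open>m' = m / g\<close> columns and \<open>n' = n / g\<close> rows, so the constant \<open>g\<close> gives the right sums.\<close>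
  moreover have "(\<chi> i j. if r i = c j then real g else 0) \<in> S"
  proof -
    have "card {j. r i = c j} = m'" for i using c(2)[of "r i"] r(1) by (auto simp: eq_commute)
    moreover have "card {i. r i = c j} = n'" for j using r(2)[of "c j"] c(1) by auto
    ultimately show ?thesis
      by (auto simp: S_def matrix_supp_def doubly_stochastic_arrays_def n m sum.If_cases)
  qed
  ultimately obtain A where A: "A extreme_point_of S"
    using extreme_point_exists_convex[of S] by blast
  have mem: "A \<in> doubly_stochastic_arrays" and supp: "matrix_supp A \<subseteq> {(i, j). r i = c j}"
    using A by (auto simp: extreme_point_of_def S_def)
  have free: "circulation_free (matrix_supp A)"
    using A unfolding S_def by (rule extreme_point_of_face_imp_circulation_free)
  define E where "E l = matrix_supp A \<inter> {i. r i = l} \<times> {j. c j = l}" for l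
  have "card (E l) + 1 \<le> n' + m'" if "l < g" for l
  proof -
    have "card (E l) + 1 \<le> card {i. r i = l} + card {j. c j = l}"
    proof (rule circulation_free_card)
      show "circulation_free (E l)" using free by (rule circulation_free_mono) (auto simp: E_def)
      show "{i. r i = l} \<noteq> {}" "{j. c j = l} \<noteq> {}"
        using r(2)[OF that] c(2)[OF that] pos by (metis card.empty less_irrefl)+
    qed (auto simp: E_def)
    then show ?thesis using that r c by simp
  qed
  then have "(\<Sum>l<g. card (E l) + 1) \<le> (\<Sum>l<g. n' + m')"
    by (intro sum_mono) auto
  then have "(\<Sum>l<g. card (E l)) + g \<le> CARD('n) + CARD('m)"
    by (simp add: sum_Suc n m distrib_left)
  moreover have "matrix_supp A \<subseteq> (\<Union>l<g. E l)"
    using supp r(1) by (force simp: E_def)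
  then have "card (matrix_supp A) \<le> (\<Sum>l<g. card (E l))"
    using card_UN_le[of "{..<g}" E] card_mono[OF finite] by (meson finite_lessThan order_trans)
  ultimately have "card (matrix_supp A) + g \<le> CARD('n) + CARD('m)" by simp
  moreover have "CARD('n) + CARD('m) \<le> card (matrix_supp A) + g"
    using supp_card_lower[OF mem] by (simp add: g_def)
  moreover have "A extreme_point_of doubly_stochastic_arrays"
    by (rule circulation_free_imp_extreme_point[OF mem free])
  ultimately show ?thesis unfolding g_def by (meson le_antisym)
qed

section \<open>Joining two components\<close>

text \<open>
  If every nonzero entry were \<open>x\<close>, every row would have degree \<open>a = m / x\<close> and every column degree
  \<open>b = n / x\<close>, so that the support would have \<open>n a = m b\<close> cells. A degree of one makes \<open>n\<close> or
  \<open>m\<close> a multiple of the other, and if both degrees are at least two, the support has at least \<open>n + m\<close>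
  cells, too many for a forest.
\<close>
lemma not_constant_on_supp:
  fixes A :: "real ^ 'm ^ 'n"
  assumes ndvd: "\<not> CARD('n) dvd CARD('m)" "\<not> CARD('m) dvd CARD('n)"
    and A: "A \<in> doubly_stochastic_arrays" and free: "circulation_free (matrix_supp A)"
  shows "\<exists>i j k l. (i, j) \<in> matrix_supp A \<and> (k, l) \<in> matrix_supp A \<and> A $ i $ j \<noteq> A $ k $ l"
proof (rule ccontr)
  assume "\<not> ?thesis"
  then obtain x where x: "\<And>i j. (i, j) \<in> matrix_supp A \<Longrightarrow> A $ i $ j = x" by metis
  then have Ax: "A $ i $ j = (if (i, j) \<in> matrix_supp A then x else 0)" for i j
    by (auto simp: matrix_supp_def)
  define R where "R i = {j. (i, j) \<in> matrix_supp A}" for i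
  define C where "C j = {i. (i, j) \<in> matrix_supp A}" for j
  have "(\<Sum>j\<in>UNIV. A $ i $ j) = real (card (R i)) * x" for i
    by (simp add: Ax sum.If_cases R_def)
  then have row: "real (card (R i)) * x = CARD('m)" for i
    using A by (simp add: doubly_stochastic_arrays_def)
  have "(\<Sum>i\<in>UNIV. A $ i $ j) = real (card (C j)) * x" for j
    by (simp add: Ax sum.If_cases C_def)
  then have col: "real (card (C j)) * x = CARD('n)" for j
    using A by (simp add: doubly_stochastic_arrays_def)
  have "x \<noteq> 0" using row[of undefined] by auto
  define a b where "a = card (R undefined)" and "b = card (C undefined)"
  have "card (R i) = a" for i
    using row[of i] row[of undefined] \<open>x \<noteq> 0\<close> unfolding a_def
    by (metis mult_right_cancel of_nat_eq_iff)
  moreover have "matrix_supp A = (SIGMA i:UNIV. R i)" by (auto simp: R_def)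
  ultimately have Ea: "card (matrix_supp A) = CARD('n) * a" by simp
  have "card (C j) = b" for j
    using col[of j] col[of undefined] \<open>x \<noteq> 0\<close> unfolding b_def
    by (metis mult_right_cancel of_nat_eq_iff)
  moreover have "matrix_supp A = prod.swap ` (SIGMA j:UNIV. C j)" by (force simp: C_def image_iff)
  ultimately have Eb: "card (matrix_supp A) = CARD('m) * b"
    by (simp add: card_image)
  have "a \<noteq> 0" "b \<noteq> 0" using row[of undefined] col[of undefined] by (auto simp: a_def b_def)
  moreover have "a \<noteq> 1" "b \<noteq> 1" using Ea Eb ndvd by (metis dvd_triv_left mult.right_neutral)+
  ultimately have "a \<ge> 2" "b \<ge> 2" by auto
  then have "CARD('n) * 2 \<le> card (matrix_supp A)" "CARD('m) * 2 \<le> card (matrix_supp A)"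
    using Ea Eb by (metis mult_le_mono2)+
  moreover have "card (matrix_supp A) + 1 \<le> CARD('n) + CARD('m)"
    by (rule circulation_free_card[OF free]) auto
  ultimately show False by linarith
qed

text \<open>
  The sets \<open>I\<close> and \<open>J\<close> are the rows and columns of a union of components. The exchange matrix \<open>D\<close>
  moves weight from the cells \<open>(p, q)\<close> and \<open>(p', q')\<close> to the cells \<open>(p, q')\<close> and \<open>(p', q)\<close>, which
  lie across the separation and were empty. The strict inequality makes \<open>(p, q)\<close> the only cell that
  is lost.

  Why no circulation \<open>B\<close> appears: the two new cells are the only ones across the separation, so
  balancing rows in \<open>I\<close> against columns in \<open>J\<close> shows that \<open>B\<close> takes the same value \<open>b\<close> on both.
  Then \<open>B - b D\<close> is a circulation on the old support and vanishes, and comparing the entries at the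
  deleted cell \<open>(p, q)\<close> gives \<open>b = 0\<close>.
\<close>
lemma join_components:
  fixes A :: "real ^ 'm ^ 'n"
  assumes A: "A \<in> doubly_stochastic_arrays" and free: "circulation_free (matrix_supp A)"
    and sep: "\<And>i j. (i, j) \<in> matrix_supp A \<Longrightarrow> i \<in> I \<longleftrightarrow> j \<in> J"
    and pq: "(p, q) \<in> matrix_supp A" "p \<in> I"
    and pq': "(p', q') \<in> matrix_supp A" "p' \<notin> I"
    and less: "A $ p $ q < A $ p' $ q'"
  shows "\<exists>A' :: real ^ 'm ^ 'n. A' \<in> doubly_stochastic_arrays \<and> circulation_free (matrix_supp A') \<and>
           card (matrix_supp A') = card (matrix_supp A) + 1"
proof -
  let ?E = "matrix_supp A"
  have J: "q \<in> J" "q' \<notin> J" using sep[OF pq(1)] sep[OF pq'(1)] pq pq' by blast+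
  have neq: "p \<noteq> p'" "q \<noteq> q'" using pq pq' J by auto
  define D :: "real ^ 'm ^ 'n"
    where "D = (\<chi> i j. (of_bool (i = p) - of_bool (i = p')) * (of_bool (j = q') - of_bool (j = q)))"
  have delta: "(\<Sum>k\<in>UNIV. of_bool (k = a) - of_bool (k = b)) = (0 :: real)" for a b :: "'k :: finite"
    by (simp add: sum_subtractf of_bool_def)
  have "(\<Sum>j\<in>UNIV. D $ i $ j) =
      (of_bool (i = p) - of_bool (i = p')) * (\<Sum>j\<in>UNIV. of_bool (j = q') - of_bool (j = q))" for i
    by (simp add: D_def sum_distrib_left)
  moreover have "(\<Sum>i\<in>UNIV. D $ i $ j) =
      (\<Sum>i\<in>UNIV. of_bool (i = p) - of_bool (i = p')) * (of_bool (j = q') - of_bool (j = q))" for j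
    by (simp add: D_def sum_distrib_right)
  ultimately have D: "circulation D" by (simp add: circulation_def delta)
  define x where "x = A $ p $ q"
  have "x > 0" using pq A by (auto simp: x_def matrix_supp_def doubly_stochastic_arrays_def less_le)
  define A' where "A' = A + x *\<^sub>R D"
  let ?E' = "?E - {(p, q)} \<union> {(p, q'), (p', q)}"
  have zero: "A $ p $ q' = 0" "A $ p' $ q = 0"
    using sep[of p q'] sep[of p' q] pq pq' J by (auto simp: matrix_supp_def)
  have A'_simps: "A' $ p $ q = 0" "A' $ p $ q' = x" "A' $ p' $ q = x" "A' $ p' $ q' = A $ p' $ q' - x"
    using neq zero by (auto simp: A'_def D_def x_def)
  have A'_other: "A' $ i $ j = A $ i $ j" if "(i, j) \<notin> {p, p'} \<times> {q, q'}" for i j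
    using that by (auto simp: A'_def D_def)
  have supp': "matrix_supp A' = ?E'"
  proof -
    have "A' $ i $ j \<noteq> 0 \<longleftrightarrow> (i, j) \<in> ?E'" for i j
    proof (cases "(i, j) \<in> {p, p'} \<times> {q, q'}")
      case True
      then show ?thesis
        using A'_simps neq \<open>x > 0\<close> less pq' by (auto simp: x_def matrix_supp_def)
    next
      case False
      then show ?thesis by (auto simp: A'_other matrix_supp_def)
    qed
    then show ?thesis unfolding matrix_supp_def[of A'] by blast
  qed
  have "A' \<in> doubly_stochastic_arrays"
  proof -
    have "A' $ i $ j \<ge> 0" for i j
    proof (cases "(i, j) \<in> {p, p'} \<times> {q, q'}")
      case True
      then show ?thesis using A'_simps \<open>x > 0\<close> less by (auto simp: x_def)
    next
      case False
      then show ?thesis using A by (simp add: A'_other doubly_stochastic_arrays_def)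
    qed
    then show ?thesis
      using A D by (simp add: A'_def doubly_stochastic_arrays_def circulation_def sum.distrib
          flip: sum_distrib_left)
  qed
  moreover have "card ?E' = card ?E + 1"
  proof -
    have "(p, q') \<notin> ?E" "(p', q) \<notin> ?E" using zero by (auto simp: matrix_supp_def)
    then have "card ?E' = card (?E - {(p, q)}) + card {(p, q'), (p', q)}"
      by (intro card_Un_disjoint) auto
    also have "\<dots> = card ?E + 1" using neq pq card_gt_0_iff[of ?E] by (auto simp: card_Diff_singleton)
    finally show ?thesis .
  qed
  moreover have "circulation_free ?E'"
    unfolding circulation_free_def
  proof (intro allI impI)
    fix B :: "real ^ 'm ^ 'n"
    assume B: "circulation B \<and> matrix_supp B \<subseteq> ?E'"
    then have B0: "B $ i $ j = 0" if "(i, j) \<notin> ?E'" for i j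
      using that by (auto simp: matrix_supp_def)
    have notE: "(i, j) \<notin> ?E" if "(i \<in> I) \<noteq> (j \<in> J)" for i j using sep[of i j] that by blast
    have B_cross: "B $ i $ j = 0" if "(i \<in> I) \<noteq> (j \<in> J)" "(i, j) \<noteq> (p, q')" "(i, j) \<noteq> (p', q)" for i j
      using notE[OF that(1)] that by (intro B0) auto
    have "(\<Sum>i\<in>I. \<Sum>j\<in>- J. B $ i $ j) = B $ p $ q'"
    proof -
      have "(\<Sum>i\<in>I. \<Sum>j\<in>- J. B $ i $ j) = (\<Sum>i\<in>I. \<Sum>j\<in>- J. if j = q' then (if i = p then B $ i $ j else 0) else 0)"
        using J pq pq' by (intro sum.cong refl) (auto intro!: B_cross)
      then show ?thesis using J pq by (simp add: sum.delta)
    qed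
    moreover have "(\<Sum>i\<in>- I. \<Sum>j\<in>J. B $ i $ j) = B $ p' $ q"
    proof -
      have "(\<Sum>i\<in>- I. \<Sum>j\<in>J. B $ i $ j) = (\<Sum>i\<in>- I. \<Sum>j\<in>J. if j = q then (if i = p' then B $ i $ j else 0) else 0)"
        using J pq pq' by (intro sum.cong refl) (auto intro!: B_cross)
      then show ?thesis using J pq' by (simp add: sum.delta)
    qed
    moreover have "(\<Sum>i\<in>I. \<Sum>j\<in>J. B $ i $ j) + (\<Sum>i\<in>I. \<Sum>j\<in>- J. B $ i $ j) = 0"
    proof -
      have "(\<Sum>j\<in>J. B $ i $ j) + (\<Sum>j\<in>- J. B $ i $ j) = (\<Sum>j\<in>UNIV. B $ i $ j)" for i
        by (subst sum.union_disjoint[symmetric]) auto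
      then show ?thesis using B by (simp add: circulation_def flip: sum.distrib)
    qed
    moreover have "(\<Sum>i\<in>I. \<Sum>j\<in>J. B $ i $ j) + (\<Sum>i\<in>- I. \<Sum>j\<in>J. B $ i $ j) = 0"
    proof -
      have "(\<Sum>i\<in>I. B $ i $ j) + (\<Sum>i\<in>- I. B $ i $ j) = (\<Sum>i\<in>UNIV. B $ i $ j)" for j
        by (subst sum.union_disjoint[symmetric]) auto
      then show ?thesis
        using B by (simp add: circulation_def sum.swap[of _ J] flip: sum.distrib)
    qed
    ultimately have eq: "B $ p' $ q = B $ p $ q'" by linarith
    define b where "b = B $ p $ q'"
    have "circulation (B - b *\<^sub>R D)"
      using B D by (simp add: circulation_def sum_subtractf flip: sum_distrib_left)
    then have BD: "B - b *\<^sub>R D = 0"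
    proof (rule circulation_freeD[OF free])
      fix i j assume ij: "(i, j) \<notin> ?E"
      show "(B - b *\<^sub>R D) $ i $ j = 0"
      proof (cases "(i, j) = (p, q') \<or> (i, j) = (p', q)")
        case True
        then show ?thesis using neq eq by (auto simp: D_def b_def)
      next
        case False
        then have "B $ i $ j = 0" using ij by (intro B0) auto
        moreover have "D $ i $ j = 0" using False ij pq pq' by (auto simp: D_def)
        ultimately show ?thesis by simp
      qed
    qed
    have "B $ p $ q = 0" using neq by (intro B0) auto
    then have "b = 0"
      using arg_cong[OF BD, of "\<lambda>M. M $ p $ q"] neq by (simp add: D_def)
    then show "B = 0" using BD by simp
  qed
  ultimately show ?thesis using supp' by metis
qed

text \<open>
  A support with at most \<open>n + m - 2\<close> cells leaves at least two labels. Of two cells with different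
  entries and the same label, at least one differs from any given cell with another label; so there are
  cells that differ both in their labels and in their entries.
\<close>
lemma ex_larger_support:
  fixes A :: "real ^ 'm ^ 'n"
  assumes ndvd: "\<not> CARD('n) dvd CARD('m)" "\<not> CARD('m) dvd CARD('n)"
    and A: "A \<in> doubly_stochastic_arrays" and free: "circulation_free (matrix_supp A)"
    and card: "card (matrix_supp A) + 2 \<le> CARD('n) + CARD('m)"
  shows "\<exists>A' :: real ^ 'm ^ 'n. A' \<in> doubly_stochastic_arrays \<and> circulation_free (matrix_supp A') \<and>
           card (matrix_supp A') = card (matrix_supp A) + 1"
proof -
  obtain h :: "'n + 'm \<Rightarrow> 'n + 'm"
    where h: "\<And>i j. (i, j) \<in> matrix_supp A \<Longrightarrow> h (Inl i) = h (Inr j)"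
      and "CARD('n) + CARD('m) \<le> card (range h) + card (matrix_supp A)"
    using component_labels[of "matrix_supp A"] by blast
  with card have two: "2 \<le> card (range h)" by simp
  have row: "\<exists>j. (i, j) \<in> matrix_supp A" for i
  proof (rule ccontr)
    assume "\<nexists>j. (i, j) \<in> matrix_supp A"
    then have "(\<Sum>j\<in>UNIV. A $ i $ j) = 0" by (simp add: matrix_supp_def)
    then show False using A by (simp add: doubly_stochastic_arrays_def)
  qed
  have other: "\<exists>k l. (k, l) \<in> matrix_supp A \<and> h (Inl k) \<noteq> h (Inl i)" for i
  proof -
    have "\<not> range h \<subseteq> {h (Inl i)}" using two card_mono[of "{h (Inl i)}" "range h"] by auto
    then obtain y where "y \<in> range h" "y \<noteq> h (Inl i)" by blast
    with labels_on_rows(2)[OF A h] row show ?thesis by metis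
  qed
  have "\<exists>i j k l. (i, j) \<in> matrix_supp A \<and> (k, l) \<in> matrix_supp A \<and>
          h (Inl i) \<noteq> h (Inl k) \<and> A $ i $ j \<noteq> A $ k $ l"
  proof -
    obtain i j k l where *: "(i, j) \<in> matrix_supp A" "(k, l) \<in> matrix_supp A" "A $ i $ j \<noteq> A $ k $ l"
      using not_constant_on_supp[OF ndvd A free] by blast
    show ?thesis
    proof (cases "h (Inl i) = h (Inl k)")
      case True
      obtain s t where "(s, t) \<in> matrix_supp A" "h (Inl s) \<noteq> h (Inl i)" using other by blast
      with * True show ?thesis by metis
    qed (use * in blast)
  qed
  then obtain i j k l where *: "(i, j) \<in> matrix_supp A" "(k, l) \<in> matrix_supp A"
    "h (Inl i) \<noteq> h (Inl k)" "A $ i $ j < A $ k $ l"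
    by (metis linorder_neqE)
  show ?thesis
    by (rule join_components[OF A free, of "{x. h (Inl x) = h (Inl i)}" "{y. h (Inr y) = h (Inl i)}" i j k l])
      (use * h in auto)
qed

section \<open>The possible support sizes\<close>

theorem theorem1p2:
  assumes "\<not> CARD('n::finite) dvd CARD('m::finite)"
    and "\<not> CARD('m) dvd CARD('n)"
  shows "(\<forall>A :: real ^ 'm ^ 'n. A extreme_point_of doubly_stochastic_arrays \<longrightarrow>
            (\<exists>s::int. 1 \<le> s \<and> s \<le> int (gcd CARD('n) CARD('m)) \<and>
               int (card (matrix_supp A)) = int CARD('n) + int CARD('m) - s)) \<and>
         (\<forall>s::int. 1 \<le> s \<and> s \<le> int (gcd CARD('n) CARD('m)) \<longrightarrow>
            (\<exists>A :: real ^ 'm ^ 'n. A extreme_point_of doubly_stochastic_arrays \<and>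
               int (card (matrix_supp A)) = int CARD('n) + int CARD('m) - s))"
proof (intro conjI allI impI)
  fix A :: "real ^ 'm ^ 'n"
  assume ext: "A extreme_point_of doubly_stochastic_arrays"
  have "card (matrix_supp A) + 1 \<le> CARD('n) + CARD('m)"
    by (rule circulation_free_card[OF extreme_point_imp_circulation_free[OF ext]]) auto
  moreover have "CARD('n) + CARD('m) \<le> card (matrix_supp A) + gcd CARD('n) CARD('m)"
    using ext by (intro supp_card_lower) (simp add: extreme_point_of_def)
  ultimately show "\<exists>s::int. 1 \<le> s \<and> s \<le> int (gcd CARD('n) CARD('m)) \<and>
      int (card (matrix_supp A)) = int CARD('n) + int CARD('m) - s"
    by (intro exI[of _ "int CARD('n) + int CARD('m) - int (card (matrix_supp A))"]) linarith
next
  fix s :: int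
  assume s: "1 \<le> s \<and> s \<le> int (gcd CARD('n) CARD('m))"
  have "\<exists>A :: real ^ 'm ^ 'n. A \<in> doubly_stochastic_arrays \<and> circulation_free (matrix_supp A) \<and>
      card (matrix_supp A) + gcd CARD('n) CARD('m) = CARD('n) + CARD('m) + k"
    if "k < gcd CARD('n) CARD('m)" for k
    using that
  proof (induction k)
    case 0
    obtain A :: "real ^ 'm ^ 'n" where "A extreme_point_of doubly_stochastic_arrays"
      "card (matrix_supp A) + gcd CARD('n) CARD('m) = CARD('n) + CARD('m)"
      using ex_extreme_point_card_gcd by blast
    then show ?case
      using extreme_point_imp_circulation_free[of A] by (auto simp: extreme_point_of_def)
  next
    case (Suc k)
    then obtain A :: "real ^ 'm ^ 'n"
      where A: "A \<in> doubly_stochastic_arrays" "circulation_free (matrix_supp A)"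
        and c: "card (matrix_supp A) + gcd CARD('n) CARD('m) = CARD('n) + CARD('m) + k" by auto
    have "card (matrix_supp A) + 2 \<le> CARD('n) + CARD('m)" using c Suc.prems by linarith
    from ex_larger_support[OF assms A this] c show ?case by force
  qed
  \<comment> \<open>Lowering the number of components \<open>gcd n m - s\<close> times leaves \<open>s\<close> of them.\<close>
  from this[of "gcd CARD('n) CARD('m) - nat s"] s
  obtain A :: "real ^ 'm ^ 'n"
    where A: "A \<in> doubly_stochastic_arrays" "circulation_free (matrix_supp A)"
      and c: "card (matrix_supp A) + gcd CARD('n) CARD('m)
        = CARD('n) + CARD('m) + (gcd CARD('n) CARD('m) - nat s)" by auto
  have "int (card (matrix_supp A)) = int CARD('n) + int CARD('m) - s" using c s by linarith
  then show "\<exists>A :: real ^ 'm ^ 'n. A extreme_point_of doubly_stochastic_arrays \<and>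
      int (card (matrix_supp A)) = int CARD('n) + int CARD('m) - s"
    using circulation_free_imp_extreme_point[OF A] by blast
qed

end
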